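(* Let $G$ be a group with a unitary symmetric partition $\mathcal{P}=\{P_0,P_1,\ldots,P_s\}$, $P_0=\{e\}$. Suppose that one of the following conditions holds: (a) $s=2$; (b) $s=3$ and $P_i=\{g,g^{-1}\}$ for some $i\in\{1,2,3\}$ and some $g \in G$; (c) $s=4$, $P_i=\{g,g^{-1}\}$ with $g$ of order $2$ or $3$, and there is a part $P_j$ such that $P_i\ast P_j\subset P_i\cup P_j\cup P_k$, for different indices $i,j,k\in\{1,2,3,4\}$; (d) $s=4$, $P_i=\{g\}$, $P_j=\{h\}$ and $gh,hg\in P_k$, for different indices $i,j,k\in\{1,2,3,4\}$. Then there is an interval metric $d$ on $G$ associated to $\mathcal{P}$.
   Context: A partition $\{P_0,\ldots,P_s\}$ of a group $G$ (into non-empty parts) is unitary if $P_0=\{e\}$, $e$ the identity, and symmetric if $P_i=P_i^{-1}$ for all $i$. In (b) and (c) the case $g=g^{-1}$, i.e. $P_i=\{g\}$, is allowed. Notation: $P_i\ast P_j=P_iP_j\cup P_jP_i=\{gh: g\in P_i,h\in P_j\}\cup\{hg:g\in P_i,h\in P_j\}$. All metrics on groups are integral (integer valued) and right translation invariant: $d(gh,g'h)=d(g,g')$ for all $g,g',h\in G$. The weight of $d$ is $w(x)=d(x,e)$. The partition induced by $d$, denoted $P(G,d)$, is the set of classes of the equivalence relation $g\sim h\Leftrightarrow w(g)=w(h)$; $d$ is associated to $\mathcal{P}$ if $P(G,d)=\mathcal{P}$. An interval metric is such a metric $d$ with finitely many weights and without gaps: if $P(G,d)$ has $n$ parts different from $\{e\}$,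 then the set of values of $w$ is exactly $\{0,1,\ldots,n\}$. *)

theory Defs
  imports "HOL-Analysis.Abstract_Metric_Spaces" "HOL-Algebra.Multiplicative_Group"
begin

(* The parts P 0, ..., P s are non-empty and pairwise disjoint (\<open>partition_on\<close>), and
   \<open>inj_on\<close> makes them distinct, so that there are exactly s + 1 of them.
   Values of P beyond s are irrelevant. *)
definition indexed_partition :: "('a, 'b) monoid_scheme \<Rightarrow> nat \<Rightarrow> (nat \<Rightarrow> 'a set) \<Rightarrow> bool" where
  "indexed_partition G s P \<longleftrightarrow> partition_on (carrier G) (P ` {0..s}) \<and> inj_on P {0..s}"

definition unitary_partition :: "('a, 'b) monoid_scheme \<Rightarrow> nat \<Rightarrow> (nat \<Rightarrow> 'a set) \<Rightarrow> bool" where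
  "unitary_partition G s P \<longleftrightarrow> indexed_partition G s P \<and> P 0 = {\<one>\<^bsub>G\<^esub>}"

definition symmetric_partition :: "('a, 'b) monoid_scheme \<Rightarrow> nat \<Rightarrow> (nat \<Rightarrow> 'a set) \<Rightarrow> bool" where
  "symmetric_partition G s P \<longleftrightarrow> indexed_partition G s P \<and> (\<forall>i\<in>{0..s}. P i = set_inv\<^bsub>G\<^esub> (P i))"

definition sym_set_mult :: "('a, 'b) monoid_scheme \<Rightarrow> 'a set \<Rightarrow> 'a set \<Rightarrow> 'a set" where
  "sym_set_mult G A B = (A <#>\<^bsub>G\<^esub> B) \<union> (B <#>\<^bsub>G\<^esub> A)"

(* \<open>Metric_space\<close> also demands non-negativity and symmetry of d outside the carrier; this only
   normalises junk values. *)
definition group_metric :: "('a, 'b) monoid_scheme \<Rightarrow> ('a \<Rightarrow> 'a \<Rightarrow> real) \<Rightarrow> bool" where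
  "group_metric G d \<longleftrightarrow>
     Metric_space (carrier G) d \<and>
     (\<forall>g\<in>carrier G. \<forall>h\<in>carrier G. d g h \<in> \<int>) \<and>
     (\<forall>g\<in>carrier G. \<forall>g'\<in>carrier G. \<forall>h\<in>carrier G.
        d (g \<otimes>\<^bsub>G\<^esub> h) (g' \<otimes>\<^bsub>G\<^esub> h) = d g g')"

definition weight :: "('a, 'b) monoid_scheme \<Rightarrow> ('a \<Rightarrow> 'a \<Rightarrow> real) \<Rightarrow> 'a \<Rightarrow> real" where
  "weight G d x = d x \<one>\<^bsub>G\<^esub>"

definition weight_partition :: "('a, 'b) monoid_scheme \<Rightarrow> ('a \<Rightarrow> 'a \<Rightarrow> real) \<Rightarrow> 'a set set" where
  "weight_partition G d =
     carrier G // {(g, h). g \<in> carrier G \<and> h \<in> carrier G \<and> weight G d g = weight G d h}"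

definition interval_metric :: "('a, 'b) monoid_scheme \<Rightarrow> ('a \<Rightarrow> 'a \<Rightarrow> real) \<Rightarrow> bool" where
  "interval_metric G d \<longleftrightarrow>
     group_metric G d \<and>
     finite (weight G d ` carrier G) \<and>
     weight G d ` carrier G = real ` {0..card (weight_partition G d - {{\<one>\<^bsub>G\<^esub>}})}"

end

theory Submission
  imports Defs
begin

text \<open>
  A weight on G is a function that vanishes exactly at the identity, is invariant under inversion
  and is subadditive; it yields the right invariant metric d(x, y) = w(x y\<inverse>). If the parts are
  numbered so that the part with number n receives weight n, subadditivity can only fail for
  products of parts with numbers i, j \<ge> 1 and i + j < s. For s = 2 there are none, for s = 3 only
  (1,1), and for s = 4 only (1,1), (1,2) and (2,1). In (b), number P_i first and the part of g^2
  second (if it is not P_i or P_0). In (c) and (d), number P_i, P_j, P_k first, second and third; then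
  P_i \<union> {e} is closed under products, in (d) because a symmetric part {g} consists of an involution.
\<close>

section \<open>Renumbering the parts by a list\<close>

text \<open>By counting, such a list exhausts \<open>{1..s}\<close>. The prefixed 0 keeps the
  identity part in place, so that position n of \<open>0 # xs\<close> names the part that will
  receive weight n.\<close>

lemma bij_betw_nth_Cons_zero:
  assumes "distinct xs" "set xs \<subseteq> {1..s}" "length xs = s"
  shows "bij_betw ((!) (0 # xs)) {0..s} {0..s}"
proof -
  have "set xs = {1..s}"
    using assms distinct_card[of xs] by (intro card_subset_eq) auto
  then have "set (0 # xs) = {0..s}"
    by auto
  moreover have "distinct (0 # xs)"
    using assms by auto
  moreover have "{..<length (0 # xs)} = {0..s}"
    using assms(3) by auto
  ultimately show ?thesis
    by (intro bij_betw_nth) auto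
qed

text \<open>Supplies the indices that the hypotheses leave unnamed, so that a partial numbering can
  be completed.\<close>

lemma exists_index_avoiding:
  assumes "finite B" "card B < s"
  obtains m where "m \<in> {1..s}" "m \<notin> B"
proof -
  have "\<not> {1..s} \<subseteq> B"
    using assms card_mono[of B "{1..s}"] by auto
  then show thesis
    using that by blast
qed

lemma unitary_partition_reindex:
  assumes "unitary_partition G s P" "bij_betw f {0..s} {0..s}" "f 0 = 0"
  shows "unitary_partition G s (P \<circ> f)"
proof -
  have "(P \<circ> f) ` {0..s} = P ` {0..s}"
    using assms(2) by (metis bij_betw_imp_surj_on image_comp)
  moreover have "inj_on (P \<circ> f) {0..s}"
    using assms by (auto simp: unitary_partition_def indexed_partition_def bij_betw_def
        intro!: comp_inj_on)
  ultimately show ?thesis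
    using assms by (simp add: unitary_partition_def indexed_partition_def)
qed

lemma symmetric_partition_reindex:
  assumes "symmetric_partition G s P" "bij_betw f {0..s} {0..s}"
  shows "symmetric_partition G s (P \<circ> f)"
proof -
  have "(P \<circ> f) ` {0..s} = P ` {0..s}"
    using assms(2) by (metis bij_betw_imp_surj_on image_comp)
  moreover have "inj_on (P \<circ> f) {0..s}"
    using assms by (auto simp: symmetric_partition_def indexed_partition_def bij_betw_def
        intro!: comp_inj_on)
  moreover have "f i \<in> {0..s}" if "i \<in> {0..s}" for i
    using assms(2) that by (rule bij_betwE[THEN bspec])
  ultimately show ?thesis
    using assms by (simp add: symmetric_partition_def indexed_partition_def)
qed

section \<open>Elements and their parts\<close>

lemma (in group) symmetric_partition_inv:
  assumes "symmetric_partition G s P" "i \<le> s" "x \<in> P i"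
  shows "inv x \<in> P i"
proof -
  have "P i = set_inv (P i)"
    using assms by (simp add: symmetric_partition_def)
  then show ?thesis
    using assms(3) by (auto simp: SET_INV_def)
qed

text \<open>Makes the number of the part of x well defined, which will be the weight of x.
  Disjointness only gives equality of the two parts; injectivity of \<open>P\<close> then gives
  equality of the indices.\<close>

lemma indexed_partition_unique_index:
  assumes "indexed_partition G s P" "x \<in> carrier G"
  shows "\<exists>!i. i \<le> s \<and> x \<in> P i"
proof (rule ex_ex1I)
  show "\<exists>i. i \<le> s \<and> x \<in> P i"
    using assms by (fastforce simp: indexed_partition_def partition_on_def)
next
  fix i j
  assume *: "i \<le> s \<and> x \<in> P i" "j \<le> s \<and> x \<in> P j"
  then have "P i = P j"
    using assms(1) disjointD[of "P ` {0..s}" "P i" "P j"]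
    by (auto simp: indexed_partition_def partition_on_def)
  then show "i = j"
    using * assms by (auto simp: indexed_partition_def dest: inj_onD)
qed

lemma indexed_partition_subset_carrier:
  assumes "indexed_partition G s P" "i \<le> s"
  shows "P i \<subseteq> carrier G"
  using assms by (auto simp: indexed_partition_def partition_on_def)

lemma indexed_partition_nonempty:
  assumes "indexed_partition G s P" "i \<le> s"
  shows "P i \<noteq> {}"
  using assms by (force simp: indexed_partition_def partition_on_def)

section \<open>From weights to right invariant metrics\<close>

text \<open>Inversion swaps the arguments in the quotient of x by y, which gives symmetry; quotients
  telescope, which gives the triangle inequality; a common right factor cancels, which gives
  invariance. Values of \<open>w\<close> in \<open>nat\<close> make the metric integral.\<close>

lemma (in group) group_metric_of_weight:
  fixes w :: "'a \<Rightarrow> nat"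
  assumes zero: "\<And>x. x \<in> carrier G \<Longrightarrow> w x = 0 \<longleftrightarrow> x = \<one>"
    and w_inv: "\<And>x. x \<in> carrier G \<Longrightarrow> w (inv x) = w x"
    and subadd: "\<And>x y. x \<in> carrier G \<Longrightarrow> y \<in> carrier G \<Longrightarrow> w (x \<otimes> y) \<le> w x + w y"
  obtains d where "group_metric G d" "\<And>x. x \<in> carrier G \<Longrightarrow> weight G d x = w x"
proof
  \<comment> \<open>\<open>Metric_space\<close> demands non-negativity and symmetry for all
    arguments, hence the default value 0 outside the carrier.\<close>
  define d where "d x y =
    (if x \<in> carrier G \<and> y \<in> carrier G then real (w (x \<otimes> inv y)) else 0)" for x y
  have quot_inv: "inv (x \<otimes> inv y) = y \<otimes> inv x" if "x \<in> carrier G" "y \<in> carrier G" for x y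
    using that by (simp add: inv_mult_group)
  have quot_mult: "(x \<otimes> inv y) \<otimes> (y \<otimes> inv z) = x \<otimes> inv z"
    if "x \<in> carrier G" "y \<in> carrier G" "z \<in> carrier G" for x y z
  proof -
    have "inv y \<otimes> (y \<otimes> inv z) = inv z"
      using that by (simp add: m_assoc[symmetric])
    then show ?thesis
      using that by (simp add: m_assoc)
  qed
  have quot_right: "(x \<otimes> z) \<otimes> inv (y \<otimes> z) = x \<otimes> inv y"
    if "x \<in> carrier G" "y \<in> carrier G" "z \<in> carrier G" for x y z
  proof -
    have "z \<otimes> (inv z \<otimes> inv y) = inv y"
      using that by (simp add: m_assoc[symmetric])
    then show ?thesis
      using that by (simp add: inv_mult_group m_assoc)
  qed
  have quot_one: "x \<otimes> inv y = \<one> \<longleftrightarrow> x = y" if "x \<in> carrier G" "y \<in> carrier G" for x y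
    by (metis that inv_closed inv_equality inv_inv r_inv)
  have "Metric_space (carrier G) d"
  proof
    fix x y
    show "0 \<le> d x y"
      by (simp add: d_def)
    show "d x y = d y x"
      unfolding d_def using quot_inv[of x y] w_inv[of "x \<otimes> inv y"] by auto
  next
    fix x y
    assume "x \<in> carrier G" "y \<in> carrier G"
    then show "d x y = 0 \<longleftrightarrow> x = y"
      by (simp add: d_def zero quot_one)
  next
    fix x y z
    assume xyz: "x \<in> carrier G" "y \<in> carrier G" "z \<in> carrier G"
    then have "w (x \<otimes> inv z) \<le> w (x \<otimes> inv y) + w (y \<otimes> inv z)"
      using subadd[of "x \<otimes> inv y" "y \<otimes> inv z"] by (simp add: quot_mult)
    then show "d x z \<le> d x y + d y z"
      using xyz by (simp add: d_def)
  qed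
  then show "group_metric G d"
    unfolding group_metric_def by (auto simp: d_def quot_right)
  show "weight G d x = w x" if "x \<in> carrier G" for x
    using that by (simp add: weight_def d_def)
qed

section \<open>The criterion on products of parts\<close>

lemma (in group) exists_interval_metric_if_products:
  assumes unitary: "unitary_partition G s P"
    and symmetric: "symmetric_partition G s P"
    and products: "\<And>i j x y. \<lbrakk>1 \<le> i; 1 \<le> j; i + j < s; x \<in> P i; y \<in> P j\<rbrakk>
      \<Longrightarrow> \<exists>k\<le>i + j. x \<otimes> y \<in> P k"
  shows "\<exists>d. interval_metric G d \<and> weight_partition G d = P ` {0..s}"
proof -
  have part: "indexed_partition G s P" and P0: "P 0 = {\<one>}"
    using unitary by (auto simp: unitary_partition_def)
  define w where "w x = (THE i. i \<le> s \<and> x \<in> P i)" for x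
  have w: "w x \<le> s" "x \<in> P (w x)" if "x \<in> carrier G" for x
    using theI'[OF indexed_partition_unique_index[OF part that]] by (auto simp: w_def)
  have w_eq: "w x = i" if "i \<le> s" "x \<in> P i" for x i
  proof -
    have "x \<in> carrier G"
      using that indexed_partition_subset_carrier[OF part that(1)] by blast
    then show ?thesis
      unfolding w_def using that indexed_partition_unique_index[OF part] by (intro the1_equality) auto
  qed
  have zero: "w x = 0 \<longleftrightarrow> x = \<one>" if "x \<in> carrier G" for x
  proof
    show "x = \<one>" if "w x = 0"
      using w(2)[OF \<open>x \<in> carrier G\<close>] that P0 by simp
    show "w x = 0" if "x = \<one>"
      using w_eq[of 0 x] that P0 by simp
  qed
  have w_inv: "w (inv x) = w x" if "x \<in> carrier G" for x
    using w_eq[OF w(1)[OF that]] symmetric_partition_inv[OF symmetric w[OF that]] by blast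
  have subadd: "w (x \<otimes> y) \<le> w x + w y" if xy: "x \<in> carrier G" "y \<in> carrier G" for x y
  \<comment> \<open>A factor of weight 0 is the identity and does not change the other factor, so
    the criterion only speaks of numbers from 1 on.\<close>
  proof (cases "w x = 0 \<or> w y = 0")
    case True
    then have "x = \<one> \<or> y = \<one>"
      using xy zero by blast
    then show ?thesis
      using xy by auto
  next
    case nonzero: False
    show ?thesis
    proof (cases "w x + w y < s")
      case True
      then obtain k where k: "k \<le> w x + w y" "x \<otimes> y \<in> P k"
        using products[OF _ _ True w(2)[OF xy(1)] w(2)[OF xy(2)]] nonzero by auto
      with True have "w (x \<otimes> y) = k"
        by (intro w_eq) auto
      with k show ?thesis
        by simp
    next
      \<comment> \<open>No weight exceeds \<open>s\<close>, so the bound is automatic here.\<close>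
      case False
      moreover have "w (x \<otimes> y) \<le> s"
        using xy by (intro w) auto
      ultimately show ?thesis
        by simp
    qed
  qed
  obtain d where metric: "group_metric G d"
    and weight: "\<And>x. x \<in> carrier G \<Longrightarrow> weight G d x = w x"
    using group_metric_of_weight[of w, OF zero w_inv subadd] by blast
  \<comment> \<open>The classes of equal weight are the parts themselves, so the metric is
    associated to the given partition.\<close>
  have level_set: "{h. h \<in> carrier G \<and> weight G d g = weight G d h} = P (w g)"
    if "g \<in> carrier G" for g
  proof (intro equalityI subsetI)
    fix h
    assume "h \<in> {h. h \<in> carrier G \<and> weight G d g = weight G d h}"
    then show "h \<in> P (w g)"
      using w(2)[of h] that by (auto simp: weight)
  next
    fix h
    assume "h \<in> P (w g)"
    then show "h \<in> {h. h \<in> carrier G \<and> weight G d g = weight G d h}"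
      using indexed_partition_subset_carrier[OF part w(1)[OF that]] w_eq[OF w(1)[OF that]] that
      by (auto simp: weight)
  qed
  \<comment> \<open>The weights have no gaps because every part is non-empty.\<close>
  have w_image: "w ` carrier G = {0..s}"
  proof
    show "w ` carrier G \<subseteq> {0..s}"
      using w by auto
    show "{0..s} \<subseteq> w ` carrier G"
    proof
      fix i
      assume "i \<in> {0..s}"
      then obtain x where "x \<in> P i" "x \<in> carrier G" "w x = i"
        using indexed_partition_nonempty[OF part, of i]
          indexed_partition_subset_carrier[OF part, of i] w_eq[of i] by auto
      then show "i \<in> w ` carrier G"
        by auto
    qed
  qed
  have "weight_partition G d
      = (\<lambda>g. {h. h \<in> carrier G \<and> weight G d g = weight G d h}) ` carrier G"
    unfolding weight_partition_def quotient_def by auto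
  also have "\<dots> = P ` w ` carrier G"
    unfolding image_image using level_set by (intro image_cong) auto
  finally have wp: "weight_partition G d = P ` {0..s}"
    by (simp add: w_image)
  \<comment> \<open>By injectivity of \<open>P\<close>, exactly \<open>s\<close> parts differ from
    the identity part, which is the largest weight as an interval metric requires.\<close>
  have "P ` {0..s} - {{\<one>}} = P ` {1..s}"
  proof -
    have "inj_on P {0..s}"
      using part by (simp add: indexed_partition_def)
    then have "P ` ({0..s} - {0}) = P ` {0..s} - P ` {0}"
      by (intro inj_on_image_set_diff) auto
    moreover have "{0..s} - {0} = {1..s}"
      by auto
    ultimately show ?thesis
      using P0 by simp
  qed
  moreover have "inj_on P {1..s}"
    using part by (auto simp: indexed_partition_def intro: inj_on_subset)
  ultimately have "card (weight_partition G d - {{\<one>}}) = s"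
    by (simp add: wp card_image)
  moreover have "weight G d ` carrier G = real ` {0..s}"
    unfolding w_image[symmetric] image_image using weight by (intro image_cong) auto
  ultimately have "interval_metric G d"
    using metric by (simp add: interval_metric_def)
  with wp show ?thesis
    by blast
qed

text \<open>Applies the criterion to the renumbered family, which has the same set of parts. Factors
  have numbers from 1 on and are looked up in \<open>xs\<close> with a shift by one; the product may
  be the identity and is looked up in \<open>0 # xs\<close>.\<close>

lemma (in group) exists_interval_metric_if_ordering:
  assumes "unitary_partition G s P" "symmetric_partition G s P"
    and "distinct xs" "set xs \<subseteq> {1..s}" "length xs = s"
    and "\<And>i j x y. \<lbrakk>1 \<le> i; 1 \<le> j; i + j < s; x \<in> P (xs ! (i - 1)); y \<in> P (xs ! (j - 1))\<rbrakk>
      \<Longrightarrow> \<exists>k\<le>i + j. x \<otimes> y \<in> P ((0 # xs) ! k)"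
  shows "\<exists>d. interval_metric G d \<and> weight_partition G d = P ` {0..s}"
proof -
  let ?f = "(!) (0 # xs)"
  have bij: "bij_betw ?f {0..s} {0..s}"
    using assms(3-5) by (rule bij_betw_nth_Cons_zero)
  have "\<exists>d. interval_metric G d \<and> weight_partition G d = (P \<circ> ?f) ` {0..s}"
  proof (rule exists_interval_metric_if_products)
    show "unitary_partition G s (P \<circ> ?f)"
      using assms(1) bij by (rule unitary_partition_reindex) simp
    show "symmetric_partition G s (P \<circ> ?f)"
      using assms(2) bij by (rule symmetric_partition_reindex)
    show "\<exists>k\<le>i + j. x \<otimes> y \<in> (P \<circ> ?f) k"
      if "1 \<le> i" "1 \<le> j" "i + j < s" "x \<in> (P \<circ> ?f) i" "y \<in> (P \<circ> ?f) j" for i j x y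
      using assms(6)[of i j x y] that by (simp add: nth_Cons')
  qed
  then show ?thesis
    using bij by (metis bij_betw_imp_surj_on image_comp)
qed

section \<open>Three and four parts besides the identity\<close>

lemma (in group) exists_interval_metric_three:
  assumes unitary: "unitary_partition G 3 P" and symmetric: "symmetric_partition G 3 P"
    and i: "i \<in> {1..3}" and g: "g \<in> carrier G" "P i = {g, inv g}"
  shows "\<exists>d. interval_metric G d \<and> weight_partition G d = P ` {0..3}"
proof -
  have part: "indexed_partition G 3 P" and P0: "P 0 = {\<one>}"
    using unitary by (auto simp: unitary_partition_def)
  obtain n where n: "n \<le> 3" "g \<otimes> g \<in> P n"
    using indexed_partition_unique_index[OF part, of "g \<otimes> g"] g by auto
  \<comment> \<open>\<open>m\<close> is to receive number 2. If the square of \<open>g\<close> lies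
    in \<open>P 0\<close> or \<open>P i\<close>, any free index will do; otherwise \<open>n\<close>
    itself is taken.\<close>
  obtain m where m: "m \<in> {1..3}" "m \<noteq> i" "n \<in> {0, i, m}"
  proof (cases "n \<in> {0, i}")
    case True
    then show thesis
      using that exists_index_avoiding[of "{i}" 3] by auto
  next
    case False
    then show thesis
      using that[of n] n by auto
  qed
  obtain l where l: "l \<in> {1..3}" "l \<notin> {i, m}"
    using exists_index_avoiding[of "{i, m}" 3] m(2) by auto
  show ?thesis
  proof (rule exists_interval_metric_if_ordering[OF unitary symmetric, of "[i, m, l]"])
    show "distinct [i, m, l]" "set [i, m, l] \<subseteq> {1..3}" "length [i, m, l] = 3"
      using i m l by auto
  next
    fix a b x y
    assume ab: "1 \<le> a" "1 \<le> b" "a + b < (3::nat)"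
      and "x \<in> P ([i, m, l] ! (a - 1))" "y \<in> P ([i, m, l] ! (b - 1))"
    moreover have "a = 1" "b = 1"
      using ab by auto
    ultimately have xy: "x \<in> {g, inv g}" "y \<in> {g, inv g}"
      using g by auto
    \<comment> \<open>The possible products are the identity, the square of \<open>g\<close> and its
      inverse; symmetry puts the inverse into the part of the square.\<close>
    have "inv (g \<otimes> g) \<in> P n"
      using symmetric_partition_inv[OF symmetric n] .
    then have "x \<otimes> y \<in> P 0 \<or> x \<otimes> y \<in> P n"
      using xy g n P0 by (auto simp: inv_mult_group)
    \<comment> \<open>By the choice of \<open>m\<close>, the product has number 0, 1 or 2, hence at
      most \<open>a + b\<close>.\<close>
    then have "x \<otimes> y \<in> P ((0 # [i, m, l]) ! 0) \<or> x \<otimes> y \<in> P ((0 # [i, m, l]) ! 1)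
        \<or> x \<otimes> y \<in> P ((0 # [i, m, l]) ! 2)"
      using m by auto
    then show "\<exists>k\<le>a + b. x \<otimes> y \<in> P ((0 # [i, m, l]) ! k)"
      using \<open>a = 1\<close> \<open>b = 1\<close> by fastforce
  qed
qed

text \<open>Common form of (c) and (d): \<open>square\<close> settles the numbers (1,1), and
  \<open>product\<close> settles (1,2) and (2,1) at once, since \<open>sym_set_mult\<close> contains
  the products in both orders.\<close>

lemma (in group) exists_interval_metric_four:
  assumes unitary: "unitary_partition G 4 P" and symmetric: "symmetric_partition G 4 P"
    and ijk: "i \<in> {1..4}" "j \<in> {1..4}" "k \<in> {1..4}" "i \<noteq> j" "i \<noteq> k" "j \<noteq> k"
    and square: "P i <#> P i \<subseteq> {\<one>} \<union> P i"
    and product: "sym_set_mult G (P i) (P j) \<subseteq> P i \<union> P j \<union> P k"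
  shows "\<exists>d. interval_metric G d \<and> weight_partition G d = P ` {0..4}"
proof -
  have P0: "P 0 = {\<one>}"
    using unitary by (auto simp: unitary_partition_def)
  obtain l where l: "l \<in> {1..4}" "l \<notin> {i, j, k}"
    using exists_index_avoiding[of "{i, j, k}" 4] ijk(4-6) by auto
  let ?xs = "[i, j, k, l]"
  show ?thesis
  proof (rule exists_interval_metric_if_ordering[OF unitary symmetric, of ?xs])
    show "distinct ?xs" "set ?xs \<subseteq> {1..4}" "length ?xs = 4"
      using ijk l by auto
  next
    fix a b x y
    assume ab: "1 \<le> a" "1 \<le> b" "a + b < (4::nat)"
      and x: "x \<in> P (?xs ! (a - 1))" and y: "y \<in> P (?xs ! (b - 1))"
    from ab consider "a = 1" "b = 1" | "a + b = 3" "{a, b} = {1, 2}"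
      by fastforce
    then show "\<exists>n\<le>a + b. x \<otimes> y \<in> P ((0 # ?xs) ! n)"
    proof cases
      case 1
      then have "x \<otimes> y \<in> P i <#> P i"
        using x y by (auto simp: set_mult_def)
      then have "x \<otimes> y \<in> P ((0 # ?xs) ! 0) \<or> x \<otimes> y \<in> P ((0 # ?xs) ! 1)"
        using square P0 by auto
      with 1 show ?thesis
        by fastforce
    next
      case 2
      then have "x \<otimes> y \<in> sym_set_mult G (P i) (P j)"
        using x y by (fastforce simp: doubleton_eq_iff sym_set_mult_def set_mult_def)
      \<comment> \<open>\<open>P i\<close>, \<open>P j\<close> and \<open>P k\<close> have numbers
        1, 2 and 3, all at most \<open>a + b = 3\<close>.\<close>
      then have "\<exists>n\<in>{1, 2, 3}. x \<otimes> y \<in> P ((0 # ?xs) ! n)"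
        using product by (auto simp: numeral_eq_Suc)
      then obtain n where "n \<in> {1, 2, 3}" "x \<otimes> y \<in> P ((0 # ?xs) ! n)"
        by blast
      then show ?thesis
        using 2(1) by (intro exI[of _ n]) auto
    qed
  qed
qed

text \<open>The square of \<open>g\<close> is the identity for order 2 and the inverse of
  \<open>g\<close> for order 3; the remaining products are the identity and the inverse of that
  square.\<close>

lemma (in group) set_mult_pair_inv_of_ord:
  assumes "g \<in> carrier G" "ord g \<in> {2, 3}"
  shows "{g, inv g} <#> {g, inv g} \<subseteq> {\<one>} \<union> {g, inv g}"
proof -
  have pow: "g [^] ord g = \<one>"
    using assms(1) by (rule pow_ord_eq_1)
  have "g \<otimes> g = \<one> \<or> g \<otimes> g = inv g"
    using assms(2)
  proof (elim insertE emptyE)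
    assume "ord g = 2"
    then show ?thesis
      using pow assms(1) by (simp add: numeral_eq_Suc)
  next
    assume "ord g = 3"
    then have "(g \<otimes> g) \<otimes> g = \<one>"
      using pow assms(1) by (simp add: numeral_eq_Suc)
    then show ?thesis
      using assms(1) by (simp add: inv_equality)
  qed
  then have "g \<otimes> g \<in> {\<one>, g, inv g}" "inv (g \<otimes> g) \<in> {\<one>, g, inv g}"
    using assms(1) by auto
  then show ?thesis
    using assms(1) by (auto simp: set_mult_def inv_mult_group)
qed

section \<open>The four cases combined\<close>

theorem proposition2p7:
  fixes G :: "('a, 'b) monoid_scheme" (structure)
    and P :: "nat \<Rightarrow> 'a set" and s :: nat
  assumes "group G"
    and "unitary_partition G s P"
    and "symmetric_partition G s P"
    and "s = 2
       \<or> (s = 3 \<and> (\<exists>i\<in>{1..3}. \<exists>g\<in>carrier G. P i = {g, inv g}))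
       \<or> (s = 4 \<and> (\<exists>i\<in>{1..4}. \<exists>j\<in>{1..4}. \<exists>k\<in>{1..4}. i \<noteq> j \<and> i \<noteq> k \<and> j \<noteq> k \<and>
            (\<exists>g\<in>carrier G. P i = {g, inv g} \<and> group.ord G g \<in> {2, 3}) \<and>
            sym_set_mult G (P i) (P j) \<subseteq> P i \<union> P j \<union> P k))
       \<or> (s = 4 \<and> (\<exists>i\<in>{1..4}. \<exists>j\<in>{1..4}. \<exists>k\<in>{1..4}. i \<noteq> j \<and> i \<noteq> k \<and> j \<noteq> k \<and>
            (\<exists>g\<in>carrier G. \<exists>h\<in>carrier G. P i = {g} \<and> P j = {h} \<and>
               g \<otimes> h \<in> P k \<and> h \<otimes> g \<in> P k)))"
  shows "\<exists>d. interval_metric G d \<and> weight_partition G d = P ` {0..s}"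
proof -
  interpret group G by (rule assms(1))
  note unitary = assms(2) and symmetric = assms(3)
  from assms(4) show ?thesis
  proof (elim disjE conjE bexE)
    \<comment> \<open>Two numbers from 1 on never have a sum below 2, so the condition on products
      is vacuous.\<close>
    assume "s = 2"
    then show ?thesis
      using exists_interval_metric_if_products[OF unitary symmetric] by auto
  next
    fix i g
    assume "s = 3" "i \<in> {1..3}" "g \<in> carrier G" "P i = {g, inv g}"
    then show ?thesis
      using exists_interval_metric_three unitary symmetric by blast
  next
    fix i j k g
    assume "s = 4" and ijk: "i \<in> {1..4}" "j \<in> {1..4}" "k \<in> {1..4}" "i \<noteq> j" "i \<noteq> k" "j \<noteq> k"
      and g: "g \<in> carrier G" "P i = {g, inv g}" "ord g \<in> {2, 3}"
      and product: "sym_set_mult G (P i) (P j) \<subseteq> P i \<union> P j \<union> P k"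
    have "P i <#> P i \<subseteq> {\<one>} \<union> P i"
      unfolding g(2) using g(1,3) by (rule set_mult_pair_inv_of_ord)
    then show ?thesis
      using exists_interval_metric_four[OF _ _ ijk _ product] unitary symmetric \<open>s = 4\<close> by blast
  next
    fix i j k g h
    assume "s = 4" and ijk: "i \<in> {1..4}" "j \<in> {1..4}" "k \<in> {1..4}" "i \<noteq> j" "i \<noteq> k" "j \<noteq> k"
      and g: "g \<in> carrier G" "P i = {g}" and h: "h \<in> carrier G" "P j = {h}"
      and gh: "g \<otimes> h \<in> P k" "h \<otimes> g \<in> P k"
    have "inv g = g"
      using symmetric_partition_inv[OF symmetric, of i g] ijk g \<open>s = 4\<close> by auto
    then have "g \<otimes> g = \<one>"
      using g(1) by (metis r_inv)
    then have "P i <#> P i \<subseteq> {\<one>} \<union> P i"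
      using g by (simp add: set_mult_def)
    \<comment> \<open>The parts are singletons, so the only products are those of \<open>g\<close>
      and \<open>h\<close> in either order, and both lie in \<open>P k\<close>.\<close>
    moreover have "sym_set_mult G (P i) (P j) \<subseteq> P i \<union> P j \<union> P k"
      using g h gh by (auto simp: sym_set_mult_def set_mult_def)
    ultimately show ?thesis
      using exists_interval_metric_four[OF _ _ ijk] unitary symmetric \<open>s = 4\<close> by blast
  qed
qed

end
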